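(* Let $\Bbbk$ be a field. For all integers $n\ge3$ and $1\le q\le\lfloor n/2\rfloor$, let $\mathcal C_n$ be the cycle on $\{x_1,\ldots,x_n\}$ and $R=\Bbbk[x_1,\ldots,x_n]$. Then \[ \dim\big(R/I(\mathcal C_n)^{[q]}\big)=\Big\lfloor\frac n2\Big\rfloor+q-1 , \] where $\dim$ is Krull dimension.
   Context: A $q$-matching of a graph is a set $M$ of $q$ pairwise vertex-disjoint edges, and $V(M)$ is the set of vertices it covers. For a graph $X$, the $q$-th squarefree power $I(X)^{[q]}$ is the ideal, in the polynomial ring over $\Bbbk$ whose variables are the vertices of $X$, generated by all monomials $\prod_{u\in V(M)}u$ with $M$ a $q$-matching of $X$. *)

theory Defs
  imports "HOL-Algebra.QuotRing" "HOL-Library.Poly_Mapping" "HOL-Library.Extended_Real"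
begin

definition prime_chain :: "('a, 'b) ring_scheme \<Rightarrow> nat \<Rightarrow> (nat \<Rightarrow> 'a set) \<Rightarrow> bool" where
  "prime_chain R l P \<longleftrightarrow> (\<forall>i\<le>l. primeideal (P i) R) \<and> (\<forall>i<l. P i \<subset> P (Suc i))"

text \<open>A chain \<open>P 0 \<subset> \<dots> \<subset> P l\<close> has length \<open>l\<close>. The supremum is taken in the extended
  reals, so the zero ring has dimension \<open>-\<infinity>\<close>.\<close>

definition krull_dim :: "('a, 'b) ring_scheme \<Rightarrow> ereal" where
  "krull_dim R = Sup {ereal (real l) | l. \<exists>P. prime_chain R l P}"

text \<open>Exponent vectors are finitely supported maps \<open>'v \<Rightarrow>\<^sub>0 nat\<close>, and polynomials are finitely
  supported families of coefficients indexed by exponent vectors; \<open>mpoly_ring V\<close> consists of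
  those whose monomials involve only the variables in \<open>V\<close>.\<close>

definition mpoly_ring :: "'v set \<Rightarrow> (('v \<Rightarrow>\<^sub>0 nat) \<Rightarrow>\<^sub>0 'k::comm_ring_1) ring" where
  "mpoly_ring V =
    \<lparr>carrier = {p. \<forall>m\<in>Poly_Mapping.keys p. Poly_Mapping.keys m \<subseteq> V},
     mult = (*), one = 1, zero = 0, add = (+)\<rparr>"

definition mvar :: "'v \<Rightarrow> ('v \<Rightarrow>\<^sub>0 nat) \<Rightarrow>\<^sub>0 'k::comm_ring_1" where
  "mvar v = Poly_Mapping.single (Poly_Mapping.single v 1) 1"

text \<open>A simple graph is the pair of its vertex set and its set of edges, the edges being
  two-element sets of vertices.\<close>

type_synonym 'v graph = "'v set \<times> 'v set set"

definition verts :: "'v graph \<Rightarrow> 'v set" where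
  "verts X = fst X"

definition edges :: "'v graph \<Rightarrow> 'v set set" where
  "edges X = snd X"

definition matching :: "'v graph \<Rightarrow> nat \<Rightarrow> 'v set set \<Rightarrow> bool" where
  "matching X q M \<longleftrightarrow> M \<subseteq> edges X \<and> finite M \<and> card M = q
     \<and> (\<forall>e\<in>M. \<forall>f\<in>M. e \<noteq> f \<longrightarrow> e \<inter> f = {})"

definition squarefree_power :: "'v graph \<Rightarrow> nat \<Rightarrow> (('v \<Rightarrow>\<^sub>0 nat) \<Rightarrow>\<^sub>0 'k::comm_ring_1) set" where
  "squarefree_power X q =
    Idl\<^bsub>mpoly_ring (verts X)\<^esub> {(\<Prod>u\<in>\<Union>M. mvar u) | M. matching X q M}"

text \<open>The vertex \<open>x\<^sub>i\<close> is represented by the number \<open>i\<close>. This is a cycle for \<open>n \<ge> 3\<close>.\<close>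

definition cycle_graph :: "nat \<Rightarrow> nat graph" where
  "cycle_graph n = ({1..n}, {{i, Suc i} | i. 1 \<le> i \<and> i < n} \<union> {{n, 1}})"

lemma cring_mpoly_ring:
  "cring (mpoly_ring V :: (('v \<Rightarrow>\<^sub>0 nat) \<Rightarrow>\<^sub>0 'k::comm_ring_1) ring)"
proof -
  define C where "C = {p :: ('v \<Rightarrow>\<^sub>0 nat) \<Rightarrow>\<^sub>0 'k. \<forall>m\<in>Poly_Mapping.keys p. Poly_Mapping.keys m \<subseteq> V}"
  define R where "R = (mpoly_ring V :: (('v \<Rightarrow>\<^sub>0 nat) \<Rightarrow>\<^sub>0 'k) ring)"
  have R: "carrier R = C" "mult R = (*)" "one R = 1" "zero R = 0" "add R = (+)"
    by (simp_all add: R_def C_def mpoly_ring_def)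
  have zero: "0 \<in> C" and one: "1 \<in> C"
    by (simp_all add: C_def)
  have uminus: "- p \<in> C" if "p \<in> C" for p
    using that by (simp add: C_def)
  have add: "p + q \<in> C" if p: "p \<in> C" and q: "q \<in> C" for p q
  proof -
    have "Poly_Mapping.keys m \<subseteq> V" if m: "m \<in> Poly_Mapping.keys (p + q)" for m
    proof -
      have "m \<in> Poly_Mapping.keys p \<union> Poly_Mapping.keys q"
        using subsetD[OF Poly_Mapping.keys_add m] .
      then show ?thesis using p q by (auto simp: C_def)
    qed
    then show ?thesis by (simp add: C_def)
  qed
  have mult: "p * q \<in> C" if p: "p \<in> C" and q: "q \<in> C" for p q
  proof -
    have "Poly_Mapping.keys m \<subseteq> V" if m: "m \<in> Poly_Mapping.keys (p * q)" for m
    proof -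
      obtain a b where ab: "m = a + b" "a \<in> Poly_Mapping.keys p" "b \<in> Poly_Mapping.keys q"
        using subsetD[OF keys_mult m] by auto
      have "Poly_Mapping.keys a \<subseteq> V" "Poly_Mapping.keys b \<subseteq> V"
        using p q ab(2,3) by (simp_all add: C_def)
      then have "Poly_Mapping.keys a \<union> Poly_Mapping.keys b \<subseteq> V" by (rule Un_least)
      then show ?thesis
        unfolding ab(1) by (rule subset_trans[OF Poly_Mapping.keys_add])
    qed
    then show ?thesis by (simp add: C_def)
  qed
  have "abelian_group R"
  proof (rule abelian_groupI, unfold R)
    fix x assume "x \<in> C"
    then show "\<exists>y\<in>C. y + x = 0"
      by (intro bexI[of _ "- x"] uminus) simp_all
  qed (simp_all add: add zero ac_simps)
  moreover have "Group.comm_monoid R"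
    by (rule comm_monoidI, unfold R) (simp_all add: mult one ac_simps)
  ultimately have "cring R"
    by (rule cringI) (simp add: R distrib_right)
  then show ?thesis
    by (simp add: R_def)
qed

end

theory Submission
  imports Defs
begin

text \<open>
  Write \<open>I\<close> for the ideal and \<open>x\<^sub>v\<close> for the variable of a vertex \<open>v\<close>. A prime ideal \<open>P \<supseteq> I\<close>
  contains a variable of every generator, so the set \<open>T\<close> of the vertices \<open>v\<close> with \<open>x\<^sub>v \<notin> P\<close> does
  not contain the vertex set of any \<open>q\<close>-matching. Modulo \<open>P\<close> every polynomial is a polynomial in
  the variables of \<open>T\<close>, so a chain of primes that starts at \<open>P\<close> has length at most \<open>card T\<close>.
  Conversely, if \<open>S\<close> contains no \<open>q\<close>-matching, the variables outside \<open>S\<close> generate a prime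
  containing \<open>I\<close>, and adding the variables of \<open>S\<close> one at a time gives a chain of length \<open>card
  S\<close>. Hence the dimension is the largest size of a vertex set that contains no \<open>q\<close>-matching
  (\<open>krull_dim_squarefree_monomial_ideal\<close>).

  The bound \<open>l \<le> card T\<close> on the length of a chain (\<open>prime_chain_length_le\<close>) is proved without
  transcendence degrees or Noether normalization. Choose \<open>g\<^sub>i \<in> P\<^sub>i\<^sub>+\<^sub>1 - P\<^sub>i\<close>, a polynomial in the
  variables of \<open>T\<close>. More than \<open>card T\<close> such polynomials satisfy a nontrivial algebraic relation,
  because their monomials of degree at most \<open>N\<close> in each \<open>g\<^sub>i\<close> outnumber the monomials in the
  variables of \<open>T\<close> that can occur in them once \<open>N\<close> is large (\<open>algebraic_dependence\<close>). Such a
  relation contradicts the choice of the \<open>g\<^sub>i\<close>: dividing out the lowest power of \<open>g\<^sub>0\<close> is possible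
  because \<open>g\<^sub>0 \<notin> P\<^sub>0\<close>, and the terms which still contain \<open>g\<^sub>0\<close> vanish modulo \<open>P\<^sub>1\<close>, so a relation
  among \<open>g\<^sub>1, g\<^sub>2, \<dots>\<close> modulo \<open>P\<^sub>1\<close> remains. Repeating this ends with a nonzero constant in the last
  prime (\<open>no_dependence_along_prime_chain\<close>). This is the argument behind the Coquand-Lombardi
  characterization of Krull dimension.

  In the cycle let \<open>m = n div 2\<close>. A set of at least \<open>m + q\<close> vertices contains both ends of \<open>q\<close>
  edges of a suitable matching with \<open>m\<close> edges, by the pigeonhole principle
  (\<open>exists_matching_cycle_graph\<close>). On the other hand the \<open>m\<close> odd numbers below \<open>2 * m\<close> together
  with \<open>2, 4, \<dots>, 2 * (q - 1)\<close> contain no \<open>q\<close>-matching, since each edge uses one of the \<open>q - 1\<close>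
  even numbers (\<open>no_matching_even_sparse\<close>). So the largest size is \<open>m + q - 1\<close>.
\<close>

section \<open>Linear dependence of families\<close>

text \<open>Stated for families rather than sets, since different monomials in given polynomials may
  have equal values; such a coincidence is itself a linear relation.\<close>

lemma (in vector_space) family_dependent:
  assumes "finite J" "finite B" "v ` J \<subseteq> span B" "card B < card J"
  shows "\<exists>c :: _ \<Rightarrow> 'a. (\<exists>j\<in>J. c j \<noteq> 0) \<and> (\<Sum>j\<in>J. scale (c j) (v j)) = 0"
proof (cases "inj_on v J")
  case True
  have "dependent (v ` J)"
  proof (rule ccontr)
    assume "\<not> dependent (v ` J)"
    then have "card (v ` J) \<le> card B"
      using independent_span_bound[OF assms(2)] assms(3) by blast
    then show False
      using assms(4) card_image[OF True] by simp
  qed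
  then obtain u where u: "\<exists>x\<in>v ` J. u x \<noteq> 0" "(\<Sum>x\<in>v ` J. scale (u x) x) = 0"
    using dependent_finite[of "v ` J"] assms(1) by auto
  then show ?thesis
    using sum.reindex[OF True, of "\<lambda>x. scale (u x) x"]
    by (intro exI[of _ "u \<circ> v"]) auto
next
  case False
  then obtain a b where ab: "a \<in> J" "b \<in> J" "a \<noteq> b" "v a = v b"
    by (auto simp: inj_on_def)
  define c :: "_ \<Rightarrow> 'a" where "c j = (if j = a then 1 else if j = b then - 1 else 0)" for j
  have "(\<Sum>j\<in>J. scale (c j) (v j)) = (\<Sum>j\<in>{a, b}. scale (c j) (v j))"
    using ab assms(1) by (intro sum.mono_neutral_right) (auto simp: c_def)
  also have "\<dots> = 0"
    using ab by (simp add: c_def)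
  finally show ?thesis
    using ab(1) by (intro exI[of _ c]) (auto simp: c_def)
qed

section \<open>Ideals of a polynomial ring\<close>

abbreviation const :: "'k \<Rightarrow> ('v \<Rightarrow>\<^sub>0 nat) \<Rightarrow>\<^sub>0 'k::comm_ring_1" where
  "const c \<equiv> Poly_Mapping.single 0 c"

lemma carrier_mpoly_ring:
  "p \<in> carrier (mpoly_ring V) \<longleftrightarrow> (\<forall>m\<in>Poly_Mapping.keys p. Poly_Mapping.keys m \<subseteq> V)"
  by (simp add: mpoly_ring_def)

lemma mpoly_ring_sel [simp]:
  "mult (mpoly_ring V) = (*)" "one (mpoly_ring V) = 1"
  "zero (mpoly_ring V) = 0" "add (mpoly_ring V) = (+)"
  by (simp_all add: mpoly_ring_def)

lemma mpoly_ring_closed: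
  shows mpoly_add_closed:
      "p \<in> carrier (mpoly_ring V) \<Longrightarrow> r \<in> carrier (mpoly_ring V) \<Longrightarrow> p + r \<in> carrier (mpoly_ring V)"
    and mpoly_mult_closed:
      "p \<in> carrier (mpoly_ring V) \<Longrightarrow> r \<in> carrier (mpoly_ring V) \<Longrightarrow> p * r \<in> carrier (mpoly_ring V)"
    and mpoly_one_closed: "1 \<in> carrier (mpoly_ring V)"
    and mpoly_zero_closed: "0 \<in> carrier (mpoly_ring V)"
    and mpoly_const_closed: "const c \<in> carrier (mpoly_ring V)"
proof -
  interpret cring "mpoly_ring V" by (rule cring_mpoly_ring)
  show "p \<in> carrier (mpoly_ring V) \<Longrightarrow> r \<in> carrier (mpoly_ring V) \<Longrightarrow> p + r \<in> carrier (mpoly_ring V)"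
    using a_closed by simp
  show "p \<in> carrier (mpoly_ring V) \<Longrightarrow> r \<in> carrier (mpoly_ring V) \<Longrightarrow> p * r \<in> carrier (mpoly_ring V)"
    using m_closed by simp
  show "1 \<in> carrier (mpoly_ring V)" using one_closed by simp
  show "0 \<in> carrier (mpoly_ring V)" using zero_closed by simp
  show "const c \<in> carrier (mpoly_ring V)" by (simp add: carrier_mpoly_ring)
qed

lemma mpoly_power_closed:
  "p \<in> carrier (mpoly_ring V) \<Longrightarrow> p ^ k \<in> carrier (mpoly_ring V)"
  by (induction k) (auto intro: mpoly_ring_closed)

lemma mpoly_prod_closed:
  "(\<And>i. i \<in> A \<Longrightarrow> f i \<in> carrier (mpoly_ring V)) \<Longrightarrow> (\<Prod>i\<in>A. f i) \<in> carrier (mpoly_ring V)"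
  by (induction A rule: infinite_finite_induct) (auto intro: mpoly_ring_closed)

lemma mpoly_sum_closed:
  "(\<And>i. i \<in> A \<Longrightarrow> f i \<in> carrier (mpoly_ring V)) \<Longrightarrow> (\<Sum>i\<in>A. f i) \<in> carrier (mpoly_ring V)"
  by (induction A rule: infinite_finite_induct) (auto intro: mpoly_ring_closed)

lemma ideal_mpoly_ring:
  assumes "ideal J (mpoly_ring V :: (('v \<Rightarrow>\<^sub>0 nat) \<Rightarrow>\<^sub>0 'k::comm_ring_1) ring)"
  shows mpoly_ideal_subset: "J \<subseteq> carrier (mpoly_ring V)"
    and mpoly_ideal_zero: "0 \<in> J"
    and mpoly_ideal_add: "\<And>a b. a \<in> J \<Longrightarrow> b \<in> J \<Longrightarrow> a + b \<in> J"
    and mpoly_ideal_mult: "\<And>a b. a \<in> J \<Longrightarrow> b \<in> carrier (mpoly_ring V) \<Longrightarrow> a * b \<in> J"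
    and mpoly_ideal_diff: "\<And>a b. a \<in> J \<Longrightarrow> b \<in> J \<Longrightarrow> a - b \<in> J"
    and mpoly_ideal_sum: "\<And>A f. (\<And>i. i \<in> A \<Longrightarrow> f i \<in> J) \<Longrightarrow> (\<Sum>i\<in>A. f i) \<in> J"
proof -
  interpret ideal J "mpoly_ring V" by fact
  show sub: "J \<subseteq> carrier (mpoly_ring V)" by (rule a_subset)
  show zero: "0 \<in> J" using additive_subgroup.zero_closed[OF is_additive_subgroup] by simp
  show add: "a + b \<in> J" if "a \<in> J" "b \<in> J" for a b
    using additive_subgroup.a_closed[OF is_additive_subgroup] that by simp
  show mult: "a * b \<in> J" if "a \<in> J" "b \<in> carrier (mpoly_ring V)" for a b
    using I_r_closed that by simp
  show "a - b \<in> J" if "a \<in> J" "b \<in> J" for a b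
  proof -
    have "a + b * const (- 1) \<in> J"
      by (intro add mult that mpoly_const_closed)
    then show ?thesis by (simp add: single_uminus)
  qed
  show "(\<Sum>i\<in>A. f i) \<in> J" if "\<And>i. i \<in> A \<Longrightarrow> f i \<in> J" for A :: "'x set" and f
    using that by (induction A rule: infinite_finite_induct) (auto intro: zero add)
qed

lemma primeideal_mpoly_ring:
  assumes "primeideal J (mpoly_ring V :: (('v \<Rightarrow>\<^sub>0 nat) \<Rightarrow>\<^sub>0 'k::comm_ring_1) ring)"
  shows mpoly_prime_ideal: "ideal J (mpoly_ring V)"
    and mpoly_prime_one: "1 \<notin> J"
    and mpoly_prime_mult:
      "\<And>a b. a * b \<in> J \<Longrightarrow> a \<in> carrier (mpoly_ring V) \<Longrightarrow> b \<in> carrier (mpoly_ring V) \<Longrightarrow> a \<in> J \<or> b \<in> J"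
proof -
  interpret primeideal J "mpoly_ring V" by fact
  show "ideal J (mpoly_ring V)" by (rule is_ideal)
  show "1 \<notin> J" using one_imp_carrier I_notcarr by auto
  show "a \<in> J \<or> b \<in> J" if "a * b \<in> J" "a \<in> carrier (mpoly_ring V)" "b \<in> carrier (mpoly_ring V)" for a b
    using I_prime that by simp
qed

lemma mpoly_prime_power:
  assumes "primeideal J (mpoly_ring V :: (('v \<Rightarrow>\<^sub>0 nat) \<Rightarrow>\<^sub>0 'k::comm_ring_1) ring)"
    and "a \<in> carrier (mpoly_ring V)" "a ^ k \<in> J"
  shows "a \<in> J"
  using assms(3)
proof (induction k)
  case 0
  then show ?case using mpoly_prime_one[OF assms(1)] by simp
next
  case (Suc k)
  then show ?case
    using mpoly_prime_mult[OF assms(1), of a "a ^ k"] assms(2) mpoly_power_closed by auto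
qed

lemma mpoly_prime_prod:
  assumes "primeideal J (mpoly_ring V :: (('v \<Rightarrow>\<^sub>0 nat) \<Rightarrow>\<^sub>0 'k::comm_ring_1) ring)"
    and "\<And>i. i \<in> A \<Longrightarrow> f i \<in> carrier (mpoly_ring V)" "(\<Prod>i\<in>A. f i) \<in> J"
  shows "\<exists>i\<in>A. f i \<in> J"
  using assms(2,3)
proof (induction A rule: infinite_finite_induct)
  case (insert x F)
  then show ?case
    using mpoly_prime_mult[OF assms(1), of "f x" "prod f F"] mpoly_prod_closed[of F f V] by auto
qed (use mpoly_prime_one[OF assms(1)] in auto)

section \<open>Primes generated by variables\<close>

definition mono_part :: "('a \<Rightarrow> bool) \<Rightarrow> ('a \<Rightarrow>\<^sub>0 'b) \<Rightarrow> ('a \<Rightarrow>\<^sub>0 'b::zero)" where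
  "mono_part Q p = Poly_Mapping.mapp (\<lambda>m c. c when Q m) p"

lemma lookup_mono_part: "Poly_Mapping.lookup (mono_part Q p) m = (Poly_Mapping.lookup p m when Q m)"
  by (auto simp: mono_part_def lookup_mapp when_def in_keys_iff)

lemma keys_mono_part: "Poly_Mapping.keys (mono_part Q p) = {m \<in> Poly_Mapping.keys p. Q m}"
  by (auto simp: in_keys_iff lookup_mono_part when_def split: if_splits)

lemma mono_part_add_mono_part: "mono_part Q p + mono_part (\<lambda>m. \<not> Q m) p = (p :: 'a \<Rightarrow>\<^sub>0 'b::monoid_add)"
  by (rule poly_mapping_eqI) (auto simp: lookup_add lookup_mono_part when_def)

lemma poly_mapping_sum_monomials:
  "(\<Sum>m\<in>Poly_Mapping.keys p. Poly_Mapping.single m (Poly_Mapping.lookup p m)) = (p :: 'a \<Rightarrow>\<^sub>0 'b::comm_monoid_add)"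
  by (rule poly_mapping_eqI)
    (simp add: lookup_sum lookup_single when_def sum.delta in_keys_iff)

text \<open>This is the ideal generated by the variables in \<open>W\<close>. Describing it by its monomials makes
  primality accessible; that it lies in every ideal containing these variables is
  \<open>var_prime_subset\<close>.\<close>
definition var_prime :: "'v set \<Rightarrow> 'v set \<Rightarrow> (('v \<Rightarrow>\<^sub>0 nat) \<Rightarrow>\<^sub>0 'k::comm_ring_1) set" where
  "var_prime V W = {p \<in> carrier (mpoly_ring V). \<forall>m\<in>Poly_Mapping.keys p. Poly_Mapping.keys m \<inter> W \<noteq> {}}"

lemma keys_plus_nat: "Poly_Mapping.keys (a + b :: 'v \<Rightarrow>\<^sub>0 nat) = Poly_Mapping.keys a \<union> Poly_Mapping.keys b"
  by (auto simp: in_keys_iff lookup_add)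

lemma ideal_var_prime: "ideal (var_prime V W) (mpoly_ring V :: (('v \<Rightarrow>\<^sub>0 nat) \<Rightarrow>\<^sub>0 'k::comm_ring_1) ring)"
proof -
  interpret cring "mpoly_ring V :: (('v \<Rightarrow>\<^sub>0 nat) \<Rightarrow>\<^sub>0 'k) ring" by (rule cring_mpoly_ring)
  let ?R = "mpoly_ring V :: (('v \<Rightarrow>\<^sub>0 nat) \<Rightarrow>\<^sub>0 'k) ring"
  have add: "a + b \<in> var_prime V W" if "a \<in> var_prime V W" "b \<in> var_prime V W" for a b :: "('v \<Rightarrow>\<^sub>0 nat) \<Rightarrow>\<^sub>0 'k"
    using that Poly_Mapping.keys_add[of a b] mpoly_add_closed[of a V b] by (force simp: var_prime_def)
  have mult: "x * a \<in> var_prime V W" if a: "a \<in> var_prime V W" and x: "x \<in> carrier ?R" for a x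
  proof -
    have "Poly_Mapping.keys m \<inter> W \<noteq> {}" if m: "m \<in> Poly_Mapping.keys (x * a)" for m
    proof -
      obtain b c where "m = b + c" "c \<in> Poly_Mapping.keys a"
        using subsetD[OF keys_mult m] by auto
      then show ?thesis using a by (auto simp: var_prime_def keys_plus_nat)
    qed
    then show ?thesis using a x mpoly_mult_closed[of x V a] by (auto simp: var_prime_def)
  qed
  show ?thesis
  proof (rule idealI)
    show "ring ?R" by (rule ring_axioms)
    show "subgroup (var_prime V W) (add_monoid ?R)"
    proof (rule add.subgroupI)
      show "var_prime V W \<subseteq> carrier ?R" by (auto simp: var_prime_def)
      show "var_prime V W \<noteq> ({} :: (('v \<Rightarrow>\<^sub>0 nat) \<Rightarrow>\<^sub>0 'k) set)"
        using mpoly_zero_closed by (auto simp: var_prime_def intro: exI[of _ 0])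
    next
      fix a :: "('v \<Rightarrow>\<^sub>0 nat) \<Rightarrow>\<^sub>0 'k" assume a: "a \<in> var_prime V W"
      then have "a \<in> carrier ?R" by (simp add: var_prime_def)
      have "- a \<in> var_prime V W" using mult[OF a mpoly_const_closed, of "- 1"] by (simp add: single_uminus)
      moreover have "\<ominus>\<^bsub>?R\<^esub> a = - a"
        using \<open>a \<in> carrier ?R\<close> \<open>- a \<in> var_prime V W\<close> by (intro minus_equality) (auto simp: var_prime_def)
      ultimately show "\<ominus>\<^bsub>?R\<^esub> a \<in> var_prime V W" by simp
    qed (use add in simp)
  qed (use mult in \<open>auto simp: mult.commute\<close>)
qed

text \<open>Modulo the ideal, each factor can be replaced by its part free of the variables in \<open>W\<close>.
  The product of these parts is again free of them, so it lies in the ideal only if it is zero,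
  and the polynomial ring is a domain. The domain property is obtained from the linear order on the
  variables: it induces an order on the monomials for which leading monomials multiply.\<close>
lemma primeideal_var_prime:
  "primeideal (var_prime V W) (mpoly_ring V :: (('v::linorder \<Rightarrow>\<^sub>0 nat) \<Rightarrow>\<^sub>0 'k::field) ring)"
proof (rule primeidealI[OF ideal_var_prime cring_mpoly_ring])
  let ?R = "mpoly_ring V :: (('v \<Rightarrow>\<^sub>0 nat) \<Rightarrow>\<^sub>0 'k) ring"
  have "(1 :: ('v \<Rightarrow>\<^sub>0 nat) \<Rightarrow>\<^sub>0 'k) \<in> carrier ?R" "(1 :: ('v \<Rightarrow>\<^sub>0 nat) \<Rightarrow>\<^sub>0 'k) \<notin> var_prime V W"
    by (auto simp: var_prime_def mpoly_one_closed)
  then show "carrier ?R \<noteq> var_prime V W" by blast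
  fix a b :: "('v \<Rightarrow>\<^sub>0 nat) \<Rightarrow>\<^sub>0 'k"
  assume ab: "a \<in> carrier ?R" "b \<in> carrier ?R" "a \<otimes>\<^bsub>?R\<^esub> b \<in> var_prime V W"
  define Q where "Q m \<longleftrightarrow> Poly_Mapping.keys m \<inter> W \<noteq> {}" for m :: "'v \<Rightarrow>\<^sub>0 nat"
  define a' b' where "a' = mono_part (\<lambda>m. \<not> Q m) a" and "b' = mono_part (\<lambda>m. \<not> Q m) b"
  have a'': "mono_part Q a \<in> var_prime V W" and b'': "mono_part Q b \<in> var_prime V W"
    using ab(1,2) by (auto simp: var_prime_def keys_mono_part Q_def carrier_mpoly_ring)
  have a: "a = mono_part Q a + a'" and b: "b = mono_part Q b + b'"
    by (simp_all add: a'_def b'_def mono_part_add_mono_part)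
  have a'c: "a' \<in> carrier ?R" using ab(1) by (auto simp: a'_def carrier_mpoly_ring keys_mono_part)
  note I = ideal_var_prime[of V W, where 'k = 'k]
  have expand: "x' * y' = x * y - (u * y + v * x')" if "x = u + x'" "y = v + y'"
    for x x' y y' u v :: "('v \<Rightarrow>\<^sub>0 nat) \<Rightarrow>\<^sub>0 'k"
    using that by (simp add: algebra_simps)
  have "a' * b' = a * b - (mono_part Q a * b + mono_part Q b * a')"
    by (rule expand[OF a b])
  also have "\<dots> \<in> var_prime V W"
    using ab(3) mpoly_ideal_mult[OF I a'' ab(2)] mpoly_ideal_mult[OF I b'' a'c]
    by (intro mpoly_ideal_diff[OF I] mpoly_ideal_add[OF I]) auto
  finally have mem: "a' * b' \<in> var_prime V W" .
  have "a' * b' = 0"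
  proof (rule ccontr)
    assume "a' * b' \<noteq> 0"
    then obtain m where m: "m \<in> Poly_Mapping.keys (a' * b')" using keys_eq_empty by blast
    then obtain c d where "m = c + d" "c \<in> Poly_Mapping.keys a'" "d \<in> Poly_Mapping.keys b'"
      using subsetD[OF keys_mult m] by auto
    then have "Poly_Mapping.keys m \<inter> W = {}" by (auto simp: a'_def b'_def keys_mono_part keys_plus_nat Q_def)
    then show False using mem m by (auto simp: var_prime_def)
  qed
  then have "a' = 0 \<or> b' = 0" by simp
  then show "a \<in> var_prime V W \<or> b \<in> var_prime V W" using a b a'' b'' by (metis add_0_right)
qed

lemma mvar_closed: "v \<in> V \<Longrightarrow> mvar v \<in> carrier (mpoly_ring V)"
  by (simp add: carrier_mpoly_ring mvar_def)

lemma mvar_in_var_prime: "v \<in> V \<Longrightarrow> (mvar v :: ('v \<Rightarrow>\<^sub>0 nat) \<Rightarrow>\<^sub>0 'k::comm_ring_1) \<in> var_prime V W \<longleftrightarrow> v \<in> W"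
  by (auto simp: var_prime_def mvar_closed) (auto simp: mvar_def)

lemma var_prime_subset:
  assumes J: "ideal J (mpoly_ring V :: (('v \<Rightarrow>\<^sub>0 nat) \<Rightarrow>\<^sub>0 'k::comm_ring_1) ring)"
    and W: "\<And>w. w \<in> W \<Longrightarrow> w \<in> V \<Longrightarrow> mvar w \<in> J"
  shows "var_prime V W \<subseteq> J"
proof
  fix p :: "('v \<Rightarrow>\<^sub>0 nat) \<Rightarrow>\<^sub>0 'k" assume p: "p \<in> var_prime V W"
  have "Poly_Mapping.single m (Poly_Mapping.lookup p m) \<in> J" if m: "m \<in> Poly_Mapping.keys p" for m
  proof -
    obtain w where w: "w \<in> W" "w \<in> Poly_Mapping.keys m" "Poly_Mapping.keys m \<subseteq> V"
      using p m unfolding var_prime_def carrier_mpoly_ring by blast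
    define r where "r = m - Poly_Mapping.single w 1"
    have "m = Poly_Mapping.single w 1 + r"
      using w(2) by (intro poly_mapping_eqI)
        (auto simp: r_def lookup_add lookup_minus lookup_single when_def in_keys_iff)
    then have *: "Poly_Mapping.single m (Poly_Mapping.lookup p m)
        = mvar w * Poly_Mapping.single r (Poly_Mapping.lookup p m)"
      by (simp add: mvar_def mult_single)
    have "Poly_Mapping.keys r \<subseteq> Poly_Mapping.keys m"
      by (auto simp: r_def in_keys_iff lookup_minus)
    then have "Poly_Mapping.single r (Poly_Mapping.lookup p m) \<in> carrier (mpoly_ring V)"
      using w(3) by (auto simp: carrier_mpoly_ring)
    then show ?thesis
      unfolding * using w W by (intro mpoly_ideal_mult[OF J]) auto
  qed
  then have "(\<Sum>m\<in>Poly_Mapping.keys p. Poly_Mapping.single m (Poly_Mapping.lookup p m)) \<in> J"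
    by (intro mpoly_ideal_sum[OF J])
  then show "p \<in> J" by (simp add: poly_mapping_sum_monomials)
qed

section \<open>Algebraic dependence\<close>

lemma vector_space_mpoly:
  "vector_space (\<lambda>(c :: 'k::field) (p :: ('v \<Rightarrow>\<^sub>0 nat) \<Rightarrow>\<^sub>0 'k). const c * p)"
  by unfold_locales
    (simp_all add: distrib_left distrib_right single_add mult_single flip: mult.assoc)

definition bounded_exponents :: "'v set \<Rightarrow> nat \<Rightarrow> ('v \<Rightarrow>\<^sub>0 nat) set" where
  "bounded_exponents T b = {m. Poly_Mapping.keys m \<subseteq> T \<and> (\<forall>v. Poly_Mapping.lookup m v \<le> b)}"

lemma card_bounded_exponents:
  assumes "finite T"
  shows "finite (bounded_exponents T b)" "card (bounded_exponents T b) \<le> (b + 1) ^ card T"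
proof -
  let ?F = "PiE T (\<lambda>_. {..b})"
  have inj: "inj_on (\<lambda>m. restrict (Poly_Mapping.lookup m) T) (bounded_exponents T b)"
  proof (rule inj_onI, rule poly_mapping_eqI)
    fix m m' :: "'a \<Rightarrow>\<^sub>0 nat" and v
    assume "m \<in> bounded_exponents T b" "m' \<in> bounded_exponents T b"
      and eq: "restrict (Poly_Mapping.lookup m) T = restrict (Poly_Mapping.lookup m') T"
    then have "Poly_Mapping.lookup m v = 0 \<and> Poly_Mapping.lookup m' v = 0" if "v \<notin> T"
      using that unfolding bounded_exponents_def in_keys_iff subset_iff by blast
    then show "Poly_Mapping.lookup m v = Poly_Mapping.lookup m' v"
      using fun_cong[OF eq, of v] by (cases "v \<in> T") auto
  qed
  have sub: "(\<lambda>m. restrict (Poly_Mapping.lookup m) T) ` bounded_exponents T b \<subseteq> ?F"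
    by (auto simp: bounded_exponents_def)
  have fin: "finite ?F" using assms by (intro finite_PiE) auto
  show "finite (bounded_exponents T b)" using inj sub fin by (rule inj_on_finite)
  have "card (bounded_exponents T b) \<le> card ?F" using inj sub fin by (rule card_inj_on_le)
  then show "card (bounded_exponents T b) \<le> (b + 1) ^ card T" using assms by (simp add: card_PiE)
qed

lemma keys_mult_bounded:
  assumes "Poly_Mapping.keys p \<subseteq> bounded_exponents T a" "Poly_Mapping.keys r \<subseteq> bounded_exponents T b"
  shows "Poly_Mapping.keys (p * r) \<subseteq> bounded_exponents T (a + b)"
proof
  fix m assume "m \<in> Poly_Mapping.keys (p * r)"
  then obtain c d where "m = c + d" "c \<in> Poly_Mapping.keys p" "d \<in> Poly_Mapping.keys r"
    using keys_mult by blast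
  moreover from this have "c \<in> bounded_exponents T a" "d \<in> bounded_exponents T b" using assms by auto
  ultimately show "m \<in> bounded_exponents T (a + b)"
    by (auto simp: bounded_exponents_def keys_plus_nat lookup_add intro: add_mono)
qed

lemma keys_one_bounded: "Poly_Mapping.keys (1 :: ('v \<Rightarrow>\<^sub>0 nat) \<Rightarrow>\<^sub>0 'k::comm_ring_1) \<subseteq> bounded_exponents T 0"
  by (auto simp: bounded_exponents_def)

lemma keys_power_bounded:
  fixes p :: "('v \<Rightarrow>\<^sub>0 nat) \<Rightarrow>\<^sub>0 'k::comm_ring_1"
  assumes "Poly_Mapping.keys p \<subseteq> bounded_exponents T b"
  shows "Poly_Mapping.keys (p ^ k) \<subseteq> bounded_exponents T (k * b)"
proof (induction k)
  case (Suc k)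
  then show ?case using keys_mult_bounded[OF assms Suc] by simp
qed (use keys_one_bounded in auto)

lemma keys_prod_bounded:
  fixes f :: "'i \<Rightarrow> ('v \<Rightarrow>\<^sub>0 nat) \<Rightarrow>\<^sub>0 'k::comm_ring_1"
  assumes "\<And>i. i \<in> A \<Longrightarrow> Poly_Mapping.keys (f i) \<subseteq> bounded_exponents T (b i)"
  shows "Poly_Mapping.keys (\<Prod>i\<in>A. f i) \<subseteq> bounded_exponents T (\<Sum>i\<in>A. b i)"
  using assms
proof (induction A rule: infinite_finite_induct)
  case (insert x F)
  then show ?case using keys_mult_bounded[of "f x" T "b x" "prod f F" "sum b F"] by auto
qed (use keys_one_bounded in auto)

lemma bounded_exponents_mono: "a \<le> b \<Longrightarrow> bounded_exponents T a \<subseteq> bounded_exponents T b"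
  by (auto simp: bounded_exponents_def intro: order_trans)

text \<open>If all exponents in the \<open>l\<close> polynomials \<open>g i\<close> are at most \<open>D\<close>, then the \<open>(N + 1) ^ l\<close>
  products \<open>\<Prod>i<l. g i ^ e i\<close> with \<open>e i \<le> N\<close> lie in the span of at most \<open>(l * N * D + 1) ^ card
  T\<close> monomials. As \<open>l > card T\<close>, the former number wins for large \<open>N\<close>. Exponents are extensional
  functions, so that they are determined by their values below \<open>l\<close>.\<close>
lemma algebraic_dependence:
  fixes g :: "nat \<Rightarrow> ('v \<Rightarrow>\<^sub>0 nat) \<Rightarrow>\<^sub>0 'k::field"
  assumes T: "finite T" "card T < l" and g: "\<And>i. i < l \<Longrightarrow> g i \<in> carrier (mpoly_ring T)"
  obtains E c where "finite E" "E \<noteq> {}" "E \<subseteq> extensional {..<l}" "\<forall>e\<in>E. c e \<noteq> 0"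
    "(\<Sum>e\<in>E. const (c e) * (\<Prod>i<l. g i ^ e i)) = 0"
proof -
  define A where "A = (\<Union>i<l. \<Union>m\<in>Poly_Mapping.keys (g i). range (Poly_Mapping.lookup m))"
  have "finite (range (Poly_Mapping.lookup m))" for m :: "'v \<Rightarrow>\<^sub>0 nat"
  proof (rule finite_subset)
    show "range (Poly_Mapping.lookup m) \<subseteq> insert 0 (Poly_Mapping.lookup m ` Poly_Mapping.keys m)"
      by (auto simp: in_keys_iff)
  qed simp
  then have finA: "finite A" by (auto simp: A_def)
  define D where "D = Max (insert 0 A)"
  have gD: "Poly_Mapping.keys (g i) \<subseteq> bounded_exponents T D" if "i < l" for i
  proof
    fix m assume m: "m \<in> Poly_Mapping.keys (g i)"
    then have "Poly_Mapping.lookup m v \<in> A" for v using that by (auto simp: A_def)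
    then have "Poly_Mapping.lookup m v \<le> D" for v using finA by (auto simp: D_def)
    then show "m \<in> bounded_exponents T D"
      using g[OF that] m by (auto simp: bounded_exponents_def carrier_mpoly_ring)
  qed
  \<comment> \<open>Since \<open>l * N * D + 1 \<le> (N + 1) * (l * D + 1)\<close>, the monomials number at most
    \<open>(N + 1) ^ card T * (l * D + 1) ^ card T\<close>. With this \<open>N\<close> the second factor is less than \<open>N + 1\<close>.\<close>
  define N where "N = (l * D + 1) ^ card T"
  define J where "J = PiE {..<l} (\<lambda>_. {..N})"
  define v where "v e = (\<Prod>i<l. g i ^ e i)" for e :: "nat \<Rightarrow> nat"
  define B where "B = (\<lambda>m. Poly_Mapping.single m (1::'k)) ` bounded_exponents T (l * (N * D))"
  interpret vs: vector_space "\<lambda>(c :: 'k) (p :: ('v \<Rightarrow>\<^sub>0 nat) \<Rightarrow>\<^sub>0 'k). const c * p"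
    by (rule vector_space_mpoly)
  have finJ: "finite J" by (auto simp: J_def intro: finite_PiE)
  have "v e \<in> vs.span B" if "e \<in> J" for e
  proof -
    have "(\<Sum>i<l. e i * D) \<le> (\<Sum>i<l. N * D)"
      using that by (intro sum_mono mult_right_mono) (auto simp: J_def)
    then have "bounded_exponents T (\<Sum>i<l. e i * D) \<subseteq> bounded_exponents T (l * (N * D))"
      by (intro bounded_exponents_mono) simp
    moreover have "Poly_Mapping.keys (v e) \<subseteq> bounded_exponents T (\<Sum>i<l. e i * D)"
      unfolding v_def by (intro keys_prod_bounded keys_power_bounded gD) auto
    ultimately have k: "Poly_Mapping.keys (v e) \<subseteq> bounded_exponents T (l * (N * D))" by blast
    have "v e = (\<Sum>m\<in>Poly_Mapping.keys (v e). const (Poly_Mapping.lookup (v e) m) * Poly_Mapping.single m 1)"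
      by (simp add: mult_single poly_mapping_sum_monomials)
    also have "\<dots> \<in> vs.span B"
      using k by (intro vs.span_sum vs.span_scale vs.span_base) (auto simp: B_def)
    finally show ?thesis .
  qed
  moreover have finB: "finite B" using card_bounded_exponents(1)[OF T(1)] by (simp add: B_def)
  moreover have "card B < card J"
  proof -
    have "card B \<le> (l * (N * D) + 1) ^ card T"
      using card_image_le[OF card_bounded_exponents(1)[OF T(1)]] card_bounded_exponents(2)[OF T(1)]
      unfolding B_def by (rule order_trans)
    also have "\<dots> \<le> ((N + 1) * (l * D + 1)) ^ card T"
      by (intro power_mono) (auto simp: algebra_simps)
    also have "\<dots> = (N + 1) ^ card T * N" by (simp only: power_mult_distrib N_def)
    also have "\<dots> < (N + 1) ^ Suc (card T)" by simp
    also have "\<dots> \<le> (N + 1) ^ l" using T(2) by (intro power_increasing) auto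
    also have "\<dots> = card J" by (simp add: J_def card_PiE)
    finally show ?thesis .
  qed
  ultimately obtain c where c: "\<exists>e\<in>J. c e \<noteq> 0" "(\<Sum>e\<in>J. const (c e) * v e) = 0"
    using vs.family_dependent[OF finJ, of B v] by blast
  define E where "E = {e \<in> J. c e \<noteq> 0}"
  have "(\<Sum>e\<in>E. const (c e) * v e) = (\<Sum>e\<in>J. const (c e) * v e)"
    using finJ by (intro sum.mono_neutral_left) (auto simp: E_def)
  moreover have "finite E" using finJ by (rule rev_finite_subset) (auto simp: E_def)
  moreover have "E \<noteq> {}" "E \<subseteq> extensional {..<l}" "\<forall>e\<in>E. c e \<noteq> 0"
    using c(1) by (auto simp: E_def J_def PiE_def)
  ultimately show ?thesis
    using c(2) unfolding v_def by (intro that[of E c]) simp_all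
qed

section \<open>Lengths of chains of primes\<close>

lemma prime_chain_mono:
  assumes "prime_chain R l P" "i \<le> j" "j \<le> l"
  shows "P i \<subseteq> P j"
  using assms(2,3)
proof (induction j rule: dec_induct)
  case (step k)
  then have "P i \<subseteq> P k" "P k \<subset> P (Suc k)"
    using assms(1) by (simp_all add: prime_chain_def)
  then show ?case by blast
qed simp

text \<open>From a relation among \<open>g j, g (j + 1), \<dots>\<close> modulo \<open>P j\<close>, split off the lowest power \<open>m\<close> of
  \<open>g j\<close>. As \<open>g j \<notin> P j\<close>, the cofactor lies in \<open>P j\<close>, hence in \<open>P (j + 1)\<close>. As \<open>g j \<in> P (j + 1)\<close>,
  the terms of the cofactor that still contain \<open>g j\<close> can be dropped. What remains is the
  relation formed by the exponents with value \<open>m\<close> at \<open>j\<close>. After \<open>l\<close> steps all remaining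
  exponents agree, so there is a single one, and its coefficient is a unit in \<open>P l\<close>.\<close>
lemma no_dependence_along_prime_chain:
  fixes P :: "nat \<Rightarrow> (('v \<Rightarrow>\<^sub>0 nat) \<Rightarrow>\<^sub>0 'k::field) set"
  assumes P: "prime_chain (mpoly_ring V) l P"
    and g: "\<And>i. i < l \<Longrightarrow> g i \<in> P (Suc i) - P i"
    and E: "finite E" "E \<noteq> {}" "E \<subseteq> extensional {..<l}" "\<forall>e\<in>E. c e \<noteq> 0"
  shows "(\<Sum>e\<in>E. const (c e) * (\<Prod>i<l. g i ^ e i)) \<notin> P 0"
proof
  assume rel: "(\<Sum>e\<in>E. const (c e) * (\<Prod>i<l. g i ^ e i)) \<in> P 0"
  have prime: "primeideal (P i) (mpoly_ring V)" if "i \<le> l" for i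
    using P that by (simp add: prime_chain_def)
  note ideal = mpoly_prime_ideal[OF prime]
  have gc: "g i \<in> carrier (mpoly_ring V)" if "i < l" for i
    using g[OF that] mpoly_ideal_subset[OF ideal[of "Suc i"]] that by auto
  have "\<exists>F\<subseteq>E. F \<noteq> {} \<and> (\<forall>e\<in>F. \<forall>e'\<in>F. \<forall>i<j. e i = e' i)
    \<and> (\<Sum>e\<in>F. const (c e) * (\<Prod>i\<in>{j..<l}. g i ^ e i)) \<in> P j" if "j \<le> l" for j
    using that
  proof (induction j)
    case 0
    then show ?case using rel E(2) by (intro exI[of _ E]) (auto simp: atLeast0LessThan)
  next
    case (Suc j)
    then obtain F where F: "F \<subseteq> E" "F \<noteq> {}" "\<forall>e\<in>F. \<forall>e'\<in>F. \<forall>i<j. e i = e' i"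
      "(\<Sum>e\<in>F. const (c e) * (\<Prod>i\<in>{j..<l}. g i ^ e i)) \<in> P j" by auto
    have j: "j < l" using Suc.prems by simp
    have finF: "finite F" using F(1) E(1) by (rule finite_subset)
    define m where "m = Min ((\<lambda>e. e j) ` F)"
    define F' where "F' = {e \<in> F. e j = m}"
    define t where "t e = const (c e) * (\<Prod>i\<in>{Suc j..<l}. g i ^ e i)" for e
    have m_le: "m \<le> e j" if "e \<in> F" for e
      using that finF by (auto simp: m_def)
    have "m \<in> (\<lambda>e. e j) ` F"
      unfolding m_def using F(2) finF by (intro Min_in) auto
    then have F'ne: "F' \<noteq> {}" by (auto simp: F'_def)
    have tc: "t e \<in> carrier (mpoly_ring V)" for e
      unfolding t_def
      by (intro mpoly_mult_closed mpoly_const_closed mpoly_prod_closed mpoly_power_closed gc) auto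
    have "(\<Sum>e\<in>F. const (c e) * (\<Prod>i\<in>{j..<l}. g i ^ e i)) = g j ^ m * (\<Sum>e\<in>F. g j ^ (e j - m) * t e)"
      unfolding sum_distrib_left
    proof (rule sum.cong[OF refl])
      fix e assume "e \<in> F"
      then have "g j ^ e j = g j ^ m * g j ^ (e j - m)"
        using m_le by (simp flip: power_add)
      then show "const (c e) * (\<Prod>i\<in>{j..<l}. g i ^ e i) = g j ^ m * (g j ^ (e j - m) * t e)"
        using j by (simp add: t_def prod.atLeast_Suc_lessThan mult_ac)
    qed
    then have "g j ^ m \<in> P j \<or> (\<Sum>e\<in>F. g j ^ (e j - m) * t e) \<in> P j"
      using F(4) j
      by (intro mpoly_prime_mult[OF prime] mpoly_power_closed mpoly_sum_closed mpoly_mult_closed gc tc) auto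
    moreover have "g j ^ m \<notin> P j"
      using mpoly_prime_power[OF prime _ , of j "g j" m] gc[OF j] g[OF j] j by auto
    ultimately have "(\<Sum>e\<in>F. g j ^ (e j - m) * t e) \<in> P (Suc j)"
      using prime_chain_mono[OF P, of j "Suc j"] j by auto
    moreover have "(\<Sum>e\<in>F - F'. g j ^ (e j - m) * t e) \<in> P (Suc j)"
    proof (rule mpoly_ideal_sum[OF ideal])
      fix e assume "e \<in> F - F'"
      then have "e j - m = Suc (e j - m - 1)" using m_le[of e] by (auto simp: F'_def)
      then have "g j ^ (e j - m) * t e = g j * (g j ^ (e j - m - 1) * t e)"
        by (metis mult.assoc power_Suc)
      also have "\<dots> \<in> P (Suc j)"
        using j g[OF j]
        by (intro mpoly_ideal_mult[OF ideal] mpoly_mult_closed mpoly_power_closed gc tc) auto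
      finally show "g j ^ (e j - m) * t e \<in> P (Suc j)" .
    qed (use j in auto)
    ultimately have "(\<Sum>e\<in>F. g j ^ (e j - m) * t e) - (\<Sum>e\<in>F - F'. g j ^ (e j - m) * t e) \<in> P (Suc j)"
      using j by (intro mpoly_ideal_diff[OF ideal]) auto
    also have "(\<Sum>e\<in>F. g j ^ (e j - m) * t e) - (\<Sum>e\<in>F - F'. g j ^ (e j - m) * t e) = (\<Sum>e\<in>F'. t e)"
    proof -
      have "F' \<subseteq> F" by (auto simp: F'_def)
      then have "(\<Sum>e\<in>F. g j ^ (e j - m) * t e)
        = (\<Sum>e\<in>F - F'. g j ^ (e j - m) * t e) + (\<Sum>e\<in>F'. g j ^ (e j - m) * t e)"
        using finF by (rule sum.subset_diff)
      moreover have "(\<Sum>e\<in>F'. g j ^ (e j - m) * t e) = (\<Sum>e\<in>F'. t e)"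
        by (rule sum.cong) (auto simp: F'_def)
      ultimately show ?thesis by simp
    qed
    finally have "(\<Sum>e\<in>F'. t e) \<in> P (Suc j)" .
    moreover have "\<forall>e\<in>F'. \<forall>e'\<in>F'. \<forall>i<Suc j. e i = e' i"
      using F(3) by (auto simp: F'_def less_Suc_eq)
    ultimately show ?case
      using F(1) F'ne unfolding t_def by (intro exI[of _ F']) (auto simp: F'_def)
  qed
  from this[of l] obtain F where F: "F \<subseteq> E" "F \<noteq> {}" "\<forall>e\<in>F. \<forall>e'\<in>F. \<forall>i<l. e i = e' i"
    "(\<Sum>e\<in>F. const (c e)) \<in> P l" by auto
  obtain e where e: "e \<in> F" using F(2) by auto
  have "F = {e}"
  proof -
    have "e' = e" if "e' \<in> F" for e'
      using F(1,3) E(3) e that by (intro extensionalityI[of _ "{..<l}"]) auto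
    then show ?thesis using e by blast
  qed
  then have "const (c e) * const (inverse (c e)) \<in> P l"
    using F(4) by (intro mpoly_ideal_mult[OF ideal] mpoly_const_closed) auto
  moreover have "c e \<noteq> 0" using e F(1) E(4) by auto
  ultimately show False
    using mpoly_prime_one[OF prime[of l]] by (simp add: mult_single)
qed

text \<open>The element of \<open>P (i + 1) - P i\<close> can be chosen among the polynomials in the variables of
  \<open>T\<close>, because the monomials involving another variable lie in \<open>P 0\<close>. Then there are \<open>l\<close>
  polynomials in \<open>card T\<close> variables that admit no algebraic relation.\<close>
lemma prime_chain_length_le:
  fixes P :: "nat \<Rightarrow> (('v \<Rightarrow>\<^sub>0 nat) \<Rightarrow>\<^sub>0 'k::field) set"
  assumes P: "prime_chain (mpoly_ring V) l P"
    and T: "finite T" "\<And>v. v \<in> V - T \<Longrightarrow> mvar v \<in> P 0"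
  shows "l \<le> card T"
proof (rule ccontr)
  assume "\<not> l \<le> card T"
  then have l: "card T < l" by simp
  have ideal: "ideal (P i) (mpoly_ring V)" if "i \<le> l" for i
    using P that by (auto simp: prime_chain_def intro: mpoly_prime_ideal)
  have sub: "var_prime V (V - T) \<subseteq> P i" if "i \<le> l" for i
    using var_prime_subset[OF ideal[of 0], of "V - T"] T(2) prime_chain_mono[OF P, of 0 i] that by auto
  have "\<exists>h. h \<in> carrier (mpoly_ring T) \<and> h \<in> P (Suc i) - P i" if i: "i < l" for i
  proof -
    obtain f where f: "f \<in> P (Suc i)" "f \<notin> P i"
      using P i unfolding prime_chain_def by blast
    define Q where "Q m \<longleftrightarrow> Poly_Mapping.keys m \<subseteq> T" for m :: "'v \<Rightarrow>\<^sub>0 nat"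
    have "f \<in> carrier (mpoly_ring V)"
      using f(1) mpoly_ideal_subset[OF ideal[of "Suc i"]] i by auto
    then have rest: "mono_part (\<lambda>m. \<not> Q m) f \<in> var_prime V (V - T)"
      by (fastforce simp: var_prime_def keys_mono_part Q_def carrier_mpoly_ring)
    have eq: "f = mono_part Q f + mono_part (\<lambda>m. \<not> Q m) f"
      by (simp add: mono_part_add_mono_part)
    have "mono_part Q f \<notin> P i"
      using f(2) rest sub[of i] mpoly_ideal_add[OF ideal[of i], of "mono_part Q f"] i eq
      by (metis less_imp_le subsetD)
    moreover have "f - mono_part (\<lambda>m. \<not> Q m) f \<in> P (Suc i)"
      using f(1) rest sub[of "Suc i"] i by (intro mpoly_ideal_diff[OF ideal]) auto
    moreover have "f - mono_part (\<lambda>m. \<not> Q m) f = mono_part Q f" using eq by (simp add: algebra_simps)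
    ultimately show ?thesis
      by (intro exI[of _ "mono_part Q f"]) (auto simp: carrier_mpoly_ring keys_mono_part Q_def)
  qed
  then obtain g where g: "\<And>i. i < l \<Longrightarrow> g i \<in> carrier (mpoly_ring T)"
    "\<And>i. i < l \<Longrightarrow> g i \<in> P (Suc i) - P i" by metis
  obtain E c where E: "finite E" "E \<noteq> {}" "E \<subseteq> extensional {..<l}" "\<forall>e\<in>E. c e \<noteq> 0"
    and rel: "(\<Sum>e\<in>E. const (c e) * (\<Prod>i<l. g i ^ e i)) = 0"
    by (rule algebraic_dependence[where g = g, OF T(1) l], erule g(1), rule that)
  have "(\<Sum>e\<in>E. const (c e) * (\<Prod>i<l. g i ^ e i)) \<notin> P 0"
    by (rule no_dependence_along_prime_chain[where g = g and c = c, OF P g(2) E])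
  then show False
    unfolding rel using mpoly_ideal_zero[OF ideal[of 0]] by simp
qed


section \<open>The dimension of a squarefree monomial quotient\<close>

lemma zero_Quot: "\<zero>\<^bsub>R Quot I\<^esub> = I"
  by (simp add: FactRing_def)

lemma (in ring) carrier_QuotE:
  assumes "X \<in> carrier (R Quot I)"
  obtains r where "r \<in> carrier R" "X = I +> r"
  using assms A_RCOSETS_def'[of R I] unfolding FactRing_def by auto

lemma (in cring) prime_chain_Quot_iff:
  assumes I: "ideal I R"
  shows "(\<exists>Q. prime_chain (R Quot I) l Q) \<longleftrightarrow> (\<exists>P. prime_chain R l P \<and> I \<subseteq> P 0)"
proof
  interpret I: ideal I R by (rule I)
  interpret h: ring_hom_ring R "R Quot I" "(+>) I" by (rule I.rcos_ring_hom_ring)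
  let ?pre = "\<lambda>Q. {r \<in> carrier R. I +> r \<in> Q}"
  assume "\<exists>Q. prime_chain (R Quot I) l Q"
  then obtain Q where Q: "prime_chain (R Quot I) l Q" ..
  have "?pre (Q i) \<subset> ?pre (Q (Suc i))" if i: "i < l" for i
  proof -
    have "Q i \<subset> Q (Suc i)" using Q i by (simp add: prime_chain_def)
    then obtain X where X: "X \<in> Q (Suc i)" "X \<notin> Q i" by blast
    have "primeideal (Q (Suc i)) (R Quot I)" using Q i by (simp add: prime_chain_def)
    then have "X \<in> carrier (R Quot I)"
      using X(1) primeideal.axioms(1) ideal.Icarr by metis
    then obtain r where "r \<in> carrier R" "X = I +> r" by (rule carrier_QuotE)
    then show ?thesis using X \<open>Q i \<subset> Q (Suc i)\<close> by blast
  qed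
  moreover have "primeideal (?pre (Q i)) R" if "i \<le> l" for i
    using Q that by (intro h.primeideal_vimage is_cring) (simp add: prime_chain_def)
  moreover have "I \<subseteq> ?pre (Q 0)"
  proof
    fix x assume x: "x \<in> I"
    have "primeideal (Q 0) (R Quot I)" using Q by (simp add: prime_chain_def)
    then have "\<zero>\<^bsub>R Quot I\<^esub> \<in> Q 0"
      by (intro additive_subgroup.zero_closed[of _ "R Quot I"] ideal.axioms(1) primeideal.axioms(1))
    then have "I +> x \<in> Q 0"
      unfolding I.a_rcos_const[OF x] zero_Quot .
    then show "x \<in> ?pre (Q 0)" using I.Icarr[OF x] by blast
  qed
  ultimately show "\<exists>P. prime_chain R l P \<and> I \<subseteq> P 0"
    by (intro exI[of _ "\<lambda>i. ?pre (Q i)"]) (simp add: prime_chain_def)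
next
  interpret I: ideal I R by (rule I)
  interpret h: ring_hom_ring R "R Quot I" "(+>) I" by (rule I.rcos_ring_hom_ring)
  assume "\<exists>P. prime_chain R l P \<and> I \<subseteq> P 0"
  then obtain P where P: "prime_chain R l P" "I \<subseteq> P 0" by blast
  have IP: "I \<subseteq> P i" if "i \<le> l" for i
    using P(2) prime_chain_mono[OF P(1) _ that, of 0] by simp
  have prime: "primeideal (P i) R" if "i \<le> l" for i
    using P(1) that by (simp add: prime_chain_def)
  note ideal = primeideal.axioms(1)[OF prime]
  let ?im = "\<lambda>J. (+>) I ` J"
  \<comment> \<open>Membership does not depend on the representative of a coset, as \<open>P i\<close> contains \<open>I\<close>.\<close>
  have mem: "I +> r \<in> ?im (P i) \<longleftrightarrow> r \<in> P i" if "i \<le> l" "r \<in> carrier R" for i r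
  proof
    assume "I +> r \<in> ?im (P i)"
    then obtain s where s: "s \<in> P i" "I +> r = I +> s" by blast
    have "r \<in> I +> s" using I.a_rcos_self[OF that(2)] s(2) by simp
    then obtain x where "x \<in> I" "r = x \<oplus> s" 
      using a_r_coset_def'[of R I s] by blast
    then show "r \<in> P i"
      using s(1) IP[OF that(1)] additive_subgroup.a_closed[OF ideal.axioms(1)[OF ideal[OF that(1)]]] by blast
  qed simp
  have "primeideal (?im (P i)) (R Quot I)" if i: "i \<le> l" for i
  proof (rule primeidealI)
    show "ideal (?im (P i)) (R Quot I)" by (rule ring_ideal_imp_quot_ideal[OF I ideal[OF i]])
    show "cring (R Quot I)" by (rule I.quotient_is_cring[OF is_cring])
    have "\<one> \<notin> P i"
      using primeideal.I_notcarr[OF prime[OF i]] ideal.one_imp_carrier[OF ideal[OF i]] by auto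
    then show "carrier (R Quot I) \<noteq> ?im (P i)"
      using mem[OF i one_closed] h.hom_closed[OF one_closed] by blast
    fix X Y assume X: "X \<in> carrier (R Quot I)" and Y: "Y \<in> carrier (R Quot I)"
      and XY: "X \<otimes>\<^bsub>R Quot I\<^esub> Y \<in> ?im (P i)"
    obtain x where x: "x \<in> carrier R" "X = I +> x" using X by (rule carrier_QuotE)
    obtain y where y: "y \<in> carrier R" "Y = I +> y" using Y by (rule carrier_QuotE)
    note xy = x(1) y(1) x(2) y(2)
    have "I +> (x \<otimes> y) \<in> ?im (P i)" using XY h.hom_mult[OF xy(1,2)] xy(3,4) by metis
    then have "x \<otimes> y \<in> P i" using mem[OF i m_closed[OF xy(1,2)]] by blast
    then show "X \<in> ?im (P i) \<or> Y \<in> ?im (P i)"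
      using primeideal.I_prime[OF prime[OF i]] xy by blast
  qed
  moreover have "?im (P i) \<subset> ?im (P (Suc i))" if i: "i < l" for i
  proof -
    have lt: "P i \<subset> P (Suc i)" using P(1) i by (simp add: prime_chain_def)
    then obtain r where r: "r \<in> P (Suc i)" "r \<notin> P i" by blast
    then have "r \<in> carrier R" using ideal.Icarr[OF ideal[of "Suc i"]] i by simp
    then have "I +> r \<notin> ?im (P i)" using mem[of i r] i r by simp
    then show ?thesis using lt r(1) by blast
  qed
  ultimately show "\<exists>Q. prime_chain (R Quot I) l Q"
    by (intro exI[of _ "\<lambda>i. ?im (P i)"]) (simp add: prime_chain_def)
qed

lemma prod_mvar_mem_var_prime:
  assumes "finite e" "e \<subseteq> V" "e \<inter> W \<noteq> {}"
  shows "(\<Prod>u\<in>e. mvar u) \<in> (var_prime V W :: (('v \<Rightarrow>\<^sub>0 nat) \<Rightarrow>\<^sub>0 'k::comm_ring_1) set)"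
proof -
  obtain w where w: "w \<in> e" "w \<in> W" using assms(3) by blast
  have "mvar w * (\<Prod>u\<in>e - {w}. mvar u) \<in> (var_prime V W :: (('v \<Rightarrow>\<^sub>0 nat) \<Rightarrow>\<^sub>0 'k) set)"
    using w assms(2)
    by (intro mpoly_ideal_mult[OF ideal_var_prime] mpoly_prod_closed mvar_closed)
      (auto simp: mvar_in_var_prime)
  then show ?thesis using assms(1) w(1) by (simp add: prod.remove)
qed

lemma prime_chain_var_prime:
  fixes V S :: "'v::linorder set"
  assumes "finite S" "S \<subseteq> V"
  obtains P :: "nat \<Rightarrow> (('v \<Rightarrow>\<^sub>0 nat) \<Rightarrow>\<^sub>0 'k::field) set"
    where "prime_chain (mpoly_ring V) (card S) P" "P 0 = var_prime V (V - S)"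
proof -
  obtain x where x: "bij_betw x {0..<card S} S"
    using ex_bij_betw_nat_finite[OF assms(1)] by blast
  define W where "W i = (V - S) \<union> x ` {0..<i}" for i
  define P where "P i = (var_prime V (W i) :: (('v \<Rightarrow>\<^sub>0 nat) \<Rightarrow>\<^sub>0 'k) set)" for i
  have "P i \<subset> P (Suc i)" if i: "i < card S" for i
  proof -
    have xi: "x i \<in> S" using x i by (auto simp: bij_betw_def)
    have "x i \<notin> x ` {0..<i}"
      using x i by (force simp: bij_betw_def dest: inj_onD)
    then have "x i \<notin> W i" "x i \<in> W (Suc i)" using xi by (auto simp: W_def)
    then have "mvar (x i) \<in> P (Suc i) - P i"
      using xi assms(2) by (auto simp: P_def mvar_in_var_prime)
    moreover have "P i \<subseteq> P (Suc i)" by (fastforce simp: P_def W_def var_prime_def)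
    ultimately show ?thesis by blast
  qed
  then have "prime_chain (mpoly_ring V) (card S) P"
    by (simp add: prime_chain_def P_def primeideal_var_prime)
  then show ?thesis by (rule that) (simp add: P_def W_def)
qed

text \<open>In terms of simplicial complexes: the dimension of a Stanley-Reisner ring is the largest
  size of a face, a face being a set that contains the support of no generator.\<close>
theorem krull_dim_squarefree_monomial_ideal:
  fixes V S :: "'v::linorder set" and F :: "'v set set"
  assumes V: "finite V" "\<And>e. e \<in> F \<Longrightarrow> e \<subseteq> V"
    and S: "S \<subseteq> V" "\<And>e. e \<in> F \<Longrightarrow> \<not> e \<subseteq> S"
    and max: "\<And>T. T \<subseteq> V \<Longrightarrow> (\<And>e. e \<in> F \<Longrightarrow> \<not> e \<subseteq> T) \<Longrightarrow> card T \<le> card S"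
  shows "krull_dim ((mpoly_ring V :: (('v \<Rightarrow>\<^sub>0 nat) \<Rightarrow>\<^sub>0 'k::field) ring)
      Quot Idl\<^bsub>mpoly_ring V\<^esub> {(\<Prod>u\<in>e. mvar u) | e. e \<in> F}) = ereal (real (card S))"
proof -
  let ?R = "mpoly_ring V :: (('v \<Rightarrow>\<^sub>0 nat) \<Rightarrow>\<^sub>0 'k) ring"
  let ?G = "{(\<Prod>u\<in>e. mvar u) | e. e \<in> F} :: (('v \<Rightarrow>\<^sub>0 nat) \<Rightarrow>\<^sub>0 'k) set"
  let ?I = "Idl\<^bsub>?R\<^esub> ?G"
  interpret cring ?R by (rule cring_mpoly_ring)
  have G: "?G \<subseteq> carrier ?R"
    using V(2) by (auto intro!: mpoly_prod_closed mvar_closed)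
  have I: "ideal ?I ?R" by (rule genideal_ideal[OF G])
  have upper: "l \<le> card S" if l: "prime_chain ?R l P" "?I \<subseteq> P 0" for l P
  proof -
    define T where "T = {v \<in> V. mvar v \<notin> P 0}"
    have prime: "primeideal (P 0) ?R" using l(1) by (simp add: prime_chain_def)
    have "\<not> e \<subseteq> T" if e: "e \<in> F" for e
    proof
      have "(\<Prod>u\<in>e. mvar u) \<in> P 0"
        using l(2) genideal_self[OF G] e by blast
      then have "\<exists>u\<in>e. mvar u \<in> P 0"
        using V(2)[OF e] by (intro mpoly_prime_prod[OF prime] mvar_closed) auto
      moreover assume "e \<subseteq> T"
      ultimately show False by (auto simp: T_def)
    qed
    then have "card T \<le> card S" by (intro max) (auto simp: T_def)
    moreover have "l \<le> card T"
      using V(1) by (intro prime_chain_length_le[OF l(1)]) (auto simp: T_def)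
    ultimately show ?thesis by simp
  qed
  obtain P :: "nat \<Rightarrow> (('v \<Rightarrow>\<^sub>0 nat) \<Rightarrow>\<^sub>0 'k) set"
    where P: "prime_chain ?R (card S) P" "P 0 = var_prime V (V - S)"
    by (rule prime_chain_var_prime[OF finite_subset[OF S(1) V(1)] S(1)])
  have "?I \<subseteq> P 0"
    unfolding P(2)
  proof (rule genideal_minimal[OF ideal_var_prime], safe)
    fix e assume e: "e \<in> F"
    show "(\<Prod>u\<in>e. mvar u) \<in> (var_prime V (V - S) :: (('v \<Rightarrow>\<^sub>0 nat) \<Rightarrow>\<^sub>0 'k) set)"
      using V(2)[OF e] S(2)[OF e] finite_subset[OF V(2)[OF e] V(1)]
      by (intro prod_mvar_mem_var_prime) auto
  qed
  then have attained: "\<exists>P. prime_chain ?R (card S) P \<and> ?I \<subseteq> P 0" using P(1) by blast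
  show ?thesis
    unfolding krull_dim_def prime_chain_Quot_iff[OF I]
  proof (intro antisym Sup_least Sup_upper)
    show "ereal (real (card S)) \<in> {ereal (real l) | l. \<exists>P. prime_chain ?R l P \<and> ?I \<subseteq> P 0}"
      using attained by blast
  qed (use upper in auto)
qed


section \<open>Matchings in induced subgraphs of a cycle\<close>

text \<open>Going around the cycle from a start \<open>v\<close> and pairing consecutive vertices after \<open>v\<close> yields
  a matching with \<open>n div 2\<close> edges, which misses exactly \<open>v\<close> if \<open>n\<close> is odd. If \<open>v \<notin> T\<close>, all of
  \<open>T\<close> is covered, and a pair not contained in \<open>T\<close> contributes at most one vertex to \<open>T\<close>; so at
  least \<open>card T - n div 2 \<ge> q\<close> of the pairs lie in \<open>T\<close>. If \<open>T\<close> consists of all vertices, all \<open>n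
  div 2 \<ge> q\<close> pairs do.\<close>
lemma exists_matching_cycle_graph:
  assumes n: "n \<ge> 3" and q: "q \<le> n div 2" and T: "T \<subseteq> {1..n}" "n div 2 + q \<le> card T"
  shows "\<exists>M. matching (cycle_graph n) q M \<and> \<Union>M \<subseteq> T"
proof -
  define m where "m = n div 2"
  have m: "2 * m \<le> n" by (simp add: m_def)
  obtain v where v: "v \<in> {1..n}" "odd n \<Longrightarrow> T \<noteq> {1..n} \<Longrightarrow> v \<notin> T"
  proof (cases "T = {1..n}")
    case True
    then show ?thesis using n by (intro that[of 1]) auto
  next
    case False
    then show ?thesis using T(1) that by blast
  qed
  define s where "s j = (v - 1 + j) mod n + 1" for j
  have s_range: "s j \<in> {1..n}" for j
    using n by (auto simp: s_def Suc_le_eq)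
  have s_inj: "inj_on s {1..n}"
  proof (rule linorder_inj_onI')
    fix i j assume ij: "i \<in> {1..n}" "j \<in> {1..n}" "i < j"
    have "\<not> n dvd j - i" using ij by (auto dest: dvd_imp_le)
    moreover have "(v - 1 + j) - (v - 1 + i) = j - i" by simp
    ultimately have "(v - 1 + j) mod n \<noteq> (v - 1 + i) mod n"
      using ij(3) mod_eq_dvd_iff_nat[of "v - 1 + i" "v - 1 + j" n] by simp
    then show "s i \<noteq> s j" by (simp add: s_def)
  qed
  have s_surj: "s ` {1..n} = {1..n}"
    using s_range card_image[OF s_inj] by (intro card_subset_eq) auto
  have s_n: "s n = v"
  proof -
    have "(v - 1 + n) mod n = v - 1"
      using v(1) by (subst mod_add_self2, intro mod_less) auto
    then show ?thesis using v(1) unfolding s_def by (simp only:) simp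
  qed
  have s_edge: "{s j, s (Suc j)} \<in> edges (cycle_graph n)" for j
  proof (cases "s j < n")
    case True
    then have "s (Suc j) = Suc (s j)"
      unfolding s_def by (simp add: mod_Suc)
    then show ?thesis using True s_range[of j] by (auto simp: cycle_graph_def edges_def)
  next
    case False
    then have "s j = n" using s_range[of j] by auto
    moreover from this have "s (Suc j) = 1"
      using n unfolding s_def by (simp add: mod_Suc)
    ultimately show ?thesis by (auto simp: cycle_graph_def edges_def)
  qed
  define e where "e k = {s (Suc (2 * k)), s (Suc (Suc (2 * k)))}" for k
  have e_disj: "e k \<inter> e k' = {}" if "k < m" "k' < m" "k \<noteq> k'" for k k'
  proof -
    have "s i \<noteq> s j"
      if "i \<in> {Suc (2 * k), Suc (Suc (2 * k))}"
        and "j \<in> {Suc (2 * k'), Suc (Suc (2 * k'))}" for i j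
    proof -
      have "i \<noteq> j" using that \<open>k \<noteq> k'\<close> by auto
      moreover have "i \<in> {1..n}" "j \<in> {1..n}" using that \<open>k < m\<close> \<open>k' < m\<close> m by auto
      ultimately show ?thesis using s_inj by (auto dest: inj_onD)
    qed
    then show ?thesis unfolding e_def by blast
  qed
  define A where "A = {k. k < m \<and> e k \<subseteq> T}"
  have "q \<le> card A"
  proof (cases "T = {1..n}")
    case True
    then have "A = {..<m}" using s_range by (auto simp: A_def e_def)
    then show ?thesis using q by (simp add: m_def)
  next
    case False
    have "T \<subseteq> (\<Union>k<m. e k \<inter> T)"
    proof
      fix x assume x: "x \<in> T"
      then obtain j where j: "j \<in> {1..n}" "x = s j" using T(1) s_surj by blast
      have "j \<noteq> n" if "odd n" using v(2)[OF that False] x j(2) s_n by auto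
      then have "j \<le> 2 * m" using j(1) by (cases "even n") (auto simp: m_def)
      then have "(j - 1) div 2 < m" using j(1) by auto
      moreover have "j = Suc (2 * ((j - 1) div 2)) \<or> j = Suc (Suc (2 * ((j - 1) div 2)))"
        using j(1) by auto
      then have "x \<in> e ((j - 1) div 2)" unfolding e_def j(2) by auto
      ultimately show "x \<in> (\<Union>k<m. e k \<inter> T)" using x by blast
    qed
    then have "card T \<le> card (\<Union>k<m. e k \<inter> T)" by (intro card_mono) (auto simp: e_def)
    also have "\<dots> \<le> (\<Sum>k<m. card (e k \<inter> T))" by (rule card_UN_le) simp
    also have "\<dots> \<le> (\<Sum>k<m. 1 + (if k \<in> A then 1 else 0))"
    proof (rule sum_mono)
      fix k assume "k \<in> {..<m}"
      have 2: "finite (e k)" "card (e k) \<le> 2" by (auto simp: e_def card_insert_if)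
      show "card (e k \<inter> T) \<le> 1 + (if k \<in> A then 1 else 0)"
      proof (cases "k \<in> A")
        case True
        then show ?thesis using 2 card_mono[of "e k" "e k \<inter> T"] by simp
      next
        case False
        then have "e k \<inter> T \<subset> e k" using \<open>k \<in> {..<m}\<close> by (auto simp: A_def)
        then show ?thesis using 2 psubset_card_mono[of "e k" "e k \<inter> T"] False by simp
      qed
    qed
    also have "\<dots> = m + card A"
    proof -
      have "A \<subseteq> {..<m}" by (auto simp: A_def)
      then show ?thesis
        by (simp only: sum.distrib) (simp add: sum.If_cases Int_absorb1)
    qed
    finally show ?thesis using T(2) by (simp add: m_def)
  qed
  then obtain A' where A': "A' \<subseteq> A" "card A' = q" "finite A'"
    by (meson obtain_subset_with_card_n)
  have A'm: "k < m" if "k \<in> A'" for k using that A'(1) by (auto simp: A_def)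
  have inj: "inj_on e A'"
  proof (rule inj_onI, rule ccontr)
    fix k k' assume "k \<in> A'" "k' \<in> A'" "e k = e k'" "k \<noteq> k'"
    then have "e k = {}" using e_disj[of k k'] A'm by auto
    then show False by (simp add: e_def)
  qed
  have "matching (cycle_graph n) q (e ` A')"
    unfolding matching_def
  proof (intro conjI ballI impI)
    show "e ` A' \<subseteq> edges (cycle_graph n)" using s_edge by (auto simp: e_def)
    show "finite (e ` A')" using A'(3) by simp
    show "card (e ` A') = q" using inj A'(2) by (simp add: card_image)
    fix x y assume "x \<in> e ` A'" "y \<in> e ` A'" "x \<noteq> y"
    then show "x \<inter> y = {}" using e_disj A'm by blast
  qed
  moreover have "\<Union>(e ` A') \<subseteq> T" using A'(1) by (auto simp: A_def)
  ultimately show ?thesis by blast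
qed

text \<open>With \<open>m = n div 2\<close> this is a largest vertex set without a \<open>q\<close>-matching: the \<open>m\<close> odd
  numbers are independent in the cycle, and each further vertex allows only one more edge in a
  matching.\<close>
definition even_sparse :: "nat \<Rightarrow> nat \<Rightarrow> nat set" where
  "even_sparse m q = (\<lambda>k. 2 * k + 1) ` {0..<m} \<union> (\<lambda>k. 2 * k) ` {1..<q}"

lemma card_even_sparse: "1 \<le> q \<Longrightarrow> card (even_sparse m q) = m + q - 1"
  unfolding even_sparse_def
  by (subst card_Un_disjoint) (auto simp: card_image inj_on_def, presburger)

text \<open>The vertex \<open>n\<close> is not in the set, so only edges between consecutive numbers occur. Each of
  them has an even end, and disjoint edges have different ones.\<close>
lemma no_matching_even_sparse:
  assumes "1 \<le> q" "q \<le> n div 2" "matching (cycle_graph n) q M"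
  shows "\<not> \<Union>M \<subseteq> even_sparse (n div 2) q"
proof
  assume sub: "\<Union>M \<subseteq> even_sparse (n div 2) q"
  have n: "n \<notin> even_sparse (n div 2) q"
    using assms(2) by (auto simp: even_sparse_def)
  have "\<exists>k\<in>{1..<q}. 2 * k \<in> e" if e: "e \<in> M" for e
  proof -
    have "e \<in> edges (cycle_graph n)" using assms(3) e by (auto simp: matching_def)
    moreover have "e \<noteq> {n, 1}" using n sub e by blast
    ultimately obtain i where "e = {i, Suc i}" by (auto simp: cycle_graph_def edges_def)
    then obtain j where j: "j \<in> e" "even j" by (metis even_Suc insertI1 insertI2)
    then have "j \<in> even_sparse (n div 2) q" using sub e by blast
    then show ?thesis using j by (auto simp: even_sparse_def)
  qed
  then obtain k where k: "\<And>e. e \<in> M \<Longrightarrow> k e \<in> {1..<q} \<and> 2 * k e \<in> e" by metis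
  have "inj_on k M"
  proof (rule inj_onI)
    fix e f assume ef: "e \<in> M" "f \<in> M" "k e = k f"
    then have "2 * k e \<in> e \<inter> f" using k[of e] k[of f] by simp
    then show "e = f" using assms(3) ef(1,2) unfolding matching_def by blast
  qed
  then have "card M \<le> card {1..<q}" using k by (intro card_inj_on_le[of k]) auto
  then show False using assms by (simp add: matching_def)
qed
theorem proposition5p4:
  fixes n q :: nat
  assumes "n \<ge> 3" and "1 \<le> q" and "q \<le> n div 2"
  shows "krull_dim ((mpoly_ring {1..n} :: ((nat \<Rightarrow>\<^sub>0 nat) \<Rightarrow>\<^sub>0 'k::field) ring)
           Quot squarefree_power (cycle_graph n) q)
         = ereal (real (n div 2) + real q - 1)"
proof -
  let ?R = "mpoly_ring {1..n} :: ((nat \<Rightarrow>\<^sub>0 nat) \<Rightarrow>\<^sub>0 'k) ring"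
  define F where "F = {\<Union>M | M. matching (cycle_graph n) q M}"
  let ?S = "even_sparse (n div 2) q"
  have verts: "verts (cycle_graph n) = {1..n}"
    by (simp add: verts_def cycle_graph_def)
  have edges: "e \<subseteq> {1..n}" if "e \<in> edges (cycle_graph n)" for e
    using that assms(1) by (auto simp: edges_def cycle_graph_def)
  have gens: "{(\<Prod>u\<in>\<Union>M. mvar u) | M. matching (cycle_graph n) q M}
      = ({(\<Prod>u\<in>e. mvar u) | e. e \<in> F} :: ((nat \<Rightarrow>\<^sub>0 nat) \<Rightarrow>\<^sub>0 'k) set)"
    unfolding F_def by blast
  have "krull_dim (?R Quot squarefree_power (cycle_graph n) q) = ereal (real (card ?S))"
    unfolding squarefree_power_def verts gens
  proof (rule krull_dim_squarefree_monomial_ideal)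
    show "finite {1..n}" by simp
    show "e \<subseteq> {1..n}" if "e \<in> F" for e
      using that edges by (fastforce simp: F_def matching_def)
    show "?S \<subseteq> {1..n}"
      using assms(3) by (auto simp: even_sparse_def)
    show "\<not> e \<subseteq> ?S" if "e \<in> F" for e
      using that no_matching_even_sparse[OF assms(2,3)] by (auto simp only: F_def mem_Collect_eq)
  next
    fix T assume T: "T \<subseteq> {1..n}" "\<And>e. e \<in> F \<Longrightarrow> \<not> e \<subseteq> T"
    have "\<not> n div 2 + q \<le> card T"
      using exists_matching_cycle_graph[OF assms(1,3) T(1)] T(2) unfolding F_def by blast
    then show "card T \<le> card ?S"
      using card_even_sparse[OF assms(2)] by simp
  qed
  also have "real (card ?S) = real (n div 2) + real q - 1"
    using card_even_sparse[OF assms(2)] assms(2) by (simp add: of_nat_diff)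
  finally show ?thesis .
qed

end
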